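(* Let $0<t_0<1/2$ and let $v$ be a smooth solution to $$\partial_t v=e^{-2v}\Delta v$$ on $B_{1/2}\times[0,t_0]$. Set $u(t)=e^{2v(t)}$ and let $K=-e^{-2v}\Delta v$ be the Gauss curvature of the metric $u(t)(dx^2+dy^2)$. Suppose that $$v\ge 1\quad\text{and}\quad |\nabla\log v|_u^2\le C_2\qquad\text{on } B_{1/2}\times[0,t_0]$$ for some $C_2>0$, and that $$t_0\le\frac{1}{8\max_{B_{1/2}\times[0,t_0]}v}.$$ Then there exists $C_3>0$ depending only on $C_2$ such that $$K\le\frac{C_3\,v}{t}$$ on $B_{1/4}$ for all $0<t\le t_0$.
   Context: $B_\rho\subset\mathbb{R}^2$ is the disc of radius $\rho$ centred at the origin. $\Delta$ and $\nabla$ are the Laplacian and gradient of the flat metric $dx^2+dy^2$. The subscript $u$ indicates norms with respect to the metric $u(dx^2+dy^2)$, so that $|\nabla f|_u^2=u^{-1}|\nabla f|^2$. The equation for $v$ is equivalent to the metrics $e^{2v}(dx^2+dy^2)$ forming a Ricci flow $\partial_t g=-2Kg$. *)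

theory Defs
  imports "HOL-Analysis.Analysis"
begin

text \<open>Discs are open; the plane is \<^typ>\<open>real ^ 2\<close> and space-time is \<^typ>\<open>(real ^ 2) \<times> real\<close>.\<close>

abbreviation disc :: "real \<Rightarrow> (real ^ 2) set" where
  "disc \<rho> \<equiv> ball 0 \<rho>"

text \<open>
  Differentiability relative to \<open>S\<close>, which need not be open: on an open disc times \<open>{0..t\<^sub>0}\<close>
  the derivatives are one-sided in time at the two ends. The relative derivative is unique
  there, because the set is convex with nonempty interior; for a set on which relative derivatives
  are not unique the definition below only asks for some choice of them.
\<close>

primrec Ck_on :: "nat \<Rightarrow> 'a::euclidean_space set \<Rightarrow> ('a \<Rightarrow> real) \<Rightarrow> bool" where
  "Ck_on 0 S f \<longleftrightarrow> continuous_on S f"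
| "Ck_on (Suc k) S f \<longleftrightarrow>
    (\<exists>f'. (\<forall>x\<in>S. (f has_derivative f' x) (at x within S)) \<and>
          (\<forall>i\<in>Basis. Ck_on k S (\<lambda>x. f' x i)))"

definition smooth_on :: "'a::euclidean_space set \<Rightarrow> ('a \<Rightarrow> real) \<Rightarrow> bool" where
  "smooth_on S f \<longleftrightarrow> (\<forall>k. Ck_on k S f)"

definition partial_deriv :: "'a::euclidean_space \<Rightarrow> ('a \<Rightarrow> real) \<Rightarrow> 'a \<Rightarrow> real" where
  "partial_deriv i f x = deriv (\<lambda>s. f (x + s *\<^sub>R i)) 0"

definition gradient :: "('a::euclidean_space \<Rightarrow> real) \<Rightarrow> 'a \<Rightarrow> 'a" where
  "gradient f x = (\<Sum>i\<in>Basis. partial_deriv i f x *\<^sub>R i)"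

definition laplacian :: "('a::euclidean_space \<Rightarrow> real) \<Rightarrow> 'a \<Rightarrow> real" where
  "laplacian f x = (\<Sum>i\<in>Basis. partial_deriv i (partial_deriv i f) x)"

text \<open>
  For the metric \<open>u (dx^2 + dy^2)\<close> the gradient of \<open>f\<close> is \<open>u\<^sup>-\<^sup>1 \<nabla>f\<close>, and its squared length in
  that metric is \<open>u |u\<^sup>-\<^sup>1 \<nabla>f|^2 = u\<^sup>-\<^sup>1 |\<nabla>f|^2\<close>, where \<open>\<nabla>\<close> and \<open>|.|\<close> are Euclidean.
\<close>

definition conf_grad_norm_sq ::
    "(real ^ 2 \<Rightarrow> real) \<Rightarrow> (real ^ 2 \<Rightarrow> real) \<Rightarrow> real ^ 2 \<Rightarrow> real" where
  "conf_grad_norm_sq u f x = inverse (u x) * (norm (gradient f x))\<^sup>2"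

text \<open>Gauss curvature of the metric \<open>e\<^sup>2\<^sup>w (dx^2 + dy^2)\<close>.\<close>

definition gauss_curvature :: "(real ^ 2 \<Rightarrow> real) \<Rightarrow> real ^ 2 \<Rightarrow> real" where
  "gauss_curvature w x = - exp (- 2 * w x) * laplacian w x"

text \<open>The equation \<open>\<partial>\<^sub>t v = e\<^sup>-\<^sup>2\<^sup>v \<Delta>v\<close> on \<open>D \<times> {0..t\<^sub>0}\<close>, with the Laplacian in space only.\<close>

definition conformal_ricci_flow_on ::
    "(real ^ 2) set \<Rightarrow> real \<Rightarrow> ((real ^ 2) \<times> real \<Rightarrow> real) \<Rightarrow> bool" where
  "conformal_ricci_flow_on D t\<^sub>0 v \<longleftrightarrow>
    (\<forall>x\<in>D. \<forall>t\<in>{0..t\<^sub>0}.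
      ((\<lambda>s. v (x, s)) has_real_derivative
        exp (- 2 * v (x, t)) * laplacian (\<lambda>y. v (y, t)) x) (at t within {0..t\<^sub>0}))"

end

theory Submission imports Defs begin

text \<open>
  Put \<open>f = ln v\<close>, \<open>Q = K / v = - \<partial>\<^sub>t f\<close> and \<open>G = |\<nabla>f|\<^sub>u^2\<close>, and let
  \<open>L g = \<Delta>\<^sub>u g + 2 \<langle>\<nabla>f, \<nabla>g\<rangle>\<^sub>u\<close>. Then \<open>(\<partial>\<^sub>t - L) Q = 2 v Q^2\<close>, while Bochner's formula gives
  \<open>(\<partial>\<^sub>t - L) G = - 2 |Hess f|\<^sub>u^2 \<le> - (\<Delta>\<^sub>u f)^2 = - (Q + G)^2\<close>. Since \<open>t v \<le> 1/8\<close>, the function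
  \<open>F = t Q + G\<close> satisfies \<open>(\<partial>\<^sub>t - L) F \<le> Q + Q^2 / 4 - (Q + G)^2\<close>, so the good term wins wherever
  \<open>Q\<close> is large. The maximum principle is applied to \<open>\<rho>^2 F\<close> with the cutoff
  \<open>\<rho> = (3/8)^2 - |x|^2\<close>; the derivatives of the cutoff are harmless because
  \<open>u \<ge> 1\<close> and \<open>G \<le> C\<^sub>2\<close>. The bound holds for \<open>t < t\<^sub>0\<close>, where all derivatives are taken at
  interior points, and extends to \<open>t = t\<^sub>0\<close> by continuity.
\<close>

subsection \<open>Relative smoothness and partial derivatives\<close>


lemma Ck_on_cong:
  assumes "Ck_on k S f" "\<And>x. x \<in> S \<Longrightarrow> g x = f x"
  shows "Ck_on k S g"
proof (cases k)
  case 0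
  then show ?thesis using assms by (auto cong: continuous_on_cong)
next
  case (Suc n)
  then show ?thesis using assms by (auto intro: has_derivative_transform)
qed

lemma Ck_on_imp_continuous_on: "Ck_on k S f \<Longrightarrow> continuous_on S f"
  by (cases k) (auto intro: has_derivative_continuous_on)

lemma Ck_on_SucD: "Ck_on (Suc k) S f \<Longrightarrow> Ck_on k S f"
proof (induction k arbitrary: f)
  case 0
  then show ?case using Ck_on_imp_continuous_on[OF 0] by simp
next
  case (Suc k)
  from Suc.prems obtain f' where
    "\<forall>x\<in>S. (f has_derivative f' x) (at x within S)" "\<forall>i\<in>Basis. Ck_on (Suc k) S (\<lambda>x. f' x i)"
    using Ck_on.simps(2) by blast
  with Suc.IH show ?case by (auto simp del: Ck_on.simps(2) simp: Ck_on.simps(2)[of k])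
qed

lemma Ck_on_subset: "Ck_on k S f \<Longrightarrow> T \<subseteq> S \<Longrightarrow> Ck_on k T f"
proof (induction k arbitrary: f)
  case 0
  then show ?case by (auto intro: continuous_on_subset)
next
  case (Suc k)
  from Suc.prems obtain f' where
    "\<forall>x\<in>S. (f has_derivative f' x) (at x within S)" "\<forall>i\<in>Basis. Ck_on k S (\<lambda>x. f' x i)"
    by auto
  with Suc show ?case by (auto intro!: exI[of _ f'] intro: has_derivative_subset)
qed

lemma Ck_on_const: "Ck_on k S (\<lambda>x. c)"
  by (induction k arbitrary: c) (auto intro!: exI[of _ "\<lambda>x h. 0"])

lemma Ck_on_add: "Ck_on k S f \<Longrightarrow> Ck_on k S g \<Longrightarrow> Ck_on k S (\<lambda>x. f x + g x)"
proof (induction k arbitrary: f g)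
  case 0
  then show ?case by (auto intro: continuous_intros)
next
  case (Suc k)
  from Suc.prems obtain f' g' where
    "\<forall>x\<in>S. (f has_derivative f' x) (at x within S)" "\<forall>i\<in>Basis. Ck_on k S (\<lambda>x. f' x i)"
    "\<forall>x\<in>S. (g has_derivative g' x) (at x within S)" "\<forall>i\<in>Basis. Ck_on k S (\<lambda>x. g' x i)"
    by auto
  with Suc.IH show ?case
    by (auto intro!: exI[of _ "\<lambda>x h. f' x h + g' x h"] has_derivative_add)
qed

lemma Ck_on_mult: "Ck_on k S f \<Longrightarrow> Ck_on k S g \<Longrightarrow> Ck_on k S (\<lambda>x. f x * g x)"
proof (induction k arbitrary: f g)
  case 0
  then show ?case by (auto intro: continuous_intros)
next
  case (Suc k)
  from Suc.prems obtain f' g' where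
    "\<forall>x\<in>S. (f has_derivative f' x) (at x within S)" "\<forall>i\<in>Basis. Ck_on k S (\<lambda>x. f' x i)"
    "\<forall>x\<in>S. (g has_derivative g' x) (at x within S)" "\<forall>i\<in>Basis. Ck_on k S (\<lambda>x. g' x i)"
    by auto
  \<comment> \<open>The derivative of the product contains \<open>f\<close> and \<open>g\<close>
    undifferentiated, so both are needed at order \<open>k\<close>.\<close>
  moreover have "Ck_on k S f" "Ck_on k S g"
    using Suc.prems by (blast intro: Ck_on_SucD)+
  ultimately show ?case
    using Suc.IH
    by (auto intro!: exI[of _ "\<lambda>x h. f x * g' x h + f' x h * g x"] has_derivative_mult Ck_on_add)
qed

lemma Ck_on_inverse:
  assumes "Ck_on k S f" "\<And>x. x \<in> S \<Longrightarrow> f x \<noteq> 0"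
  shows "Ck_on k S (\<lambda>x. inverse (f x))"
  using assms
proof (induction k arbitrary: f)
  case 0
  then show ?case by (auto intro: continuous_intros)
next
  case (Suc k)
  from Suc.prems obtain f' where f':
    "\<forall>x\<in>S. (f has_derivative f' x) (at x within S)" "\<forall>i\<in>Basis. Ck_on k S (\<lambda>x. f' x i)"
    by auto
  \<comment> \<open>The derivative of the inverse contains the inverse again; at order
    \<open>k\<close> it is covered by the induction hypothesis.\<close>
  have inv: "Ck_on k S (\<lambda>x. inverse (f x))"
    using Suc by (blast intro: Ck_on_SucD)
  \<comment> \<open>The sign is written as a factor \<open>(-1)\<close> so that
    \<open>Ck_on_mult\<close> and \<open>Ck_on_const\<close> suffice.\<close>
  have "((\<lambda>x. inverse (f x)) has_derivative
      (\<lambda>h. (-1) * (inverse (f x) * f' x h * inverse (f x)))) (at x within S)" if "x \<in> S" for x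
    using that f' Suc.prems by (auto intro!: has_derivative_inverse[THEN has_derivative_eq_rhs])
  moreover have "Ck_on k S (\<lambda>x. (-1) * (inverse (f x) * f' x i * inverse (f x)))" if "i \<in> Basis" for i
    using that f' inv by (intro Ck_on_mult Ck_on_const) auto
  ultimately show ?case
    using f' by (auto intro!: exI[of _ "\<lambda>x h. (-1) * (inverse (f x) * f' x h * inverse (f x))"])
qed

lemma Ck_on_ln:
  assumes "Ck_on k S f" "\<And>x. x \<in> S \<Longrightarrow> f x > 0"
  shows "Ck_on k S (\<lambda>x. ln (f x))"
proof (cases k)
  case 0
  with assms show ?thesis by (force intro: continuous_intros)
next
  case (Suc n)
  from assms Suc obtain f' where f':
    "\<forall>x\<in>S. (f has_derivative f' x) (at x within S)" "\<forall>i\<in>Basis. Ck_on n S (\<lambda>x. f' x i)"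
    by auto
  have "Ck_on n S (\<lambda>x. inverse (f x))"
    using Ck_on_inverse[of n S f] Ck_on_SucD[of n S f] assms Suc by fastforce
  moreover have "((\<lambda>x. ln (f x)) has_derivative (\<lambda>h. f' x h * inverse (f x))) (at x within S)"
    if "x \<in> S" for x
    using that f' assms(2) by (auto intro!: derivative_eq_intros simp: divide_inverse)
  ultimately show ?thesis
    using f' Suc by (auto intro!: exI[of _ "\<lambda>x h. f' x h * inverse (f x)"] Ck_on_mult)
qed

text \<open>Along such directions the relative derivatives of \<^const>\<open>Ck_on\<close> are genuine partial derivatives,
  also at the two ends of the time interval.\<close>

definition open_along :: "'a::real_vector \<Rightarrow> 'a set \<Rightarrow> bool" where
  "open_along e S \<longleftrightarrow> (\<forall>p\<in>S. \<forall>\<^sub>F s in nhds (0::real). p + s *\<^sub>R e \<in> S)"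

lemma open_imp_open_along:
  fixes S :: "'a::real_normed_vector set"
  assumes "open S"
  shows "open_along e S"
  unfolding open_along_def
proof
  fix p assume "p \<in> S"
  have "((\<lambda>s. p + s *\<^sub>R e) \<longlongrightarrow> p + 0 *\<^sub>R e) (nhds 0)"
    by (intro tendsto_intros) (simp add: filterlim_ident)
  then show "\<forall>\<^sub>F s in nhds (0::real). p + s *\<^sub>R e \<in> S"
    using topological_tendstoD[OF _ assms] \<open>p \<in> S\<close> by auto
qed

text \<open>Only the first factor moves, so \<open>I\<close> may be a closed time interval.\<close>

lemma open_along_Times:
  fixes U :: "'a::real_normed_vector set"
  assumes "open U"
  shows "open_along (e, 0) (U \<times> I)"
  using open_imp_open_along[OF assms, of e] by (auto simp: open_along_def)

text \<open>\<open>partial_deriv\<close> is built on the choice operator \<open>deriv\<close> and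
  has a value even without differentiability; this relation also records existence.\<close>

definition has_partial ::
    "('a::real_normed_vector \<Rightarrow> real) \<Rightarrow> 'a \<Rightarrow> real \<Rightarrow> 'a \<Rightarrow> bool" where
  "has_partial f e D p \<longleftrightarrow> ((\<lambda>s. f (p + s *\<^sub>R e)) has_real_derivative D) (at 0)"

lemma has_partial_imp_eq: "has_partial f e D p \<Longrightarrow> partial_deriv e f p = D"
  by (simp add: has_partial_def partial_deriv_def DERIV_imp_deriv)

lemma partial_deriv_works: "has_partial f e D p \<Longrightarrow> has_partial f e (partial_deriv e f p) p"
  by (metis has_partial_imp_eq)

text \<open>Chain rule along the line through \<open>p\<close>. The parameters are restricted to an
  open set \<open>T\<close> that keeps the line in \<open>S\<close>; at an interior point of
  \<open>T\<close> the restriction is harmless.\<close>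

lemma has_derivative_imp_has_partial:
  assumes "(f has_derivative f') (at p within S)" "open_along e S" "p \<in> S"
  shows "has_partial f e (f' e) p"
proof -
  have ev: "\<forall>\<^sub>F s in nhds (0::real). p + s *\<^sub>R e \<in> S"
    using assms by (auto simp: open_along_def)
  then obtain T where T: "open T" "0 \<in> T" "\<forall>s\<in>T. p + s *\<^sub>R e \<in> S"
    unfolding eventually_nhds by blast
  have "((\<lambda>s. p + s *\<^sub>R e) has_derivative (\<lambda>s. s *\<^sub>R e)) (at 0 within T)"
    by (auto intro!: derivative_eq_intros)
  moreover have "(f has_derivative f') (at (p + 0 *\<^sub>R e) within (\<lambda>s. p + s *\<^sub>R e) ` T)"
    using T assms by (auto intro: has_derivative_subset)
  ultimately have "((\<lambda>s. f (p + s *\<^sub>R e)) has_derivative (\<lambda>s. f' (s *\<^sub>R e))) (at 0 within T)"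
    by (rule has_derivative_in_compose)
  moreover have "f' (s *\<^sub>R e) = f' e * s" for s
    using linear_scale[OF has_derivative_linear[OF assms(1)], of s e] by (simp add: mult.commute)
  ultimately have "((\<lambda>s. f (p + s *\<^sub>R e)) has_derivative (*) (f' e)) (at 0 within T)"
    by (simp only:)
  then show ?thesis
    unfolding has_partial_def has_field_derivative_def at_within_open[OF T(2,1)] .
qed

text \<open>Whatever derivative \<open>f'\<close> was chosen, its value in direction
  \<open>e\<close> is the one-variable derivative, which is unique. Hence it agrees with
  \<open>partial_deriv e f\<close> on \<open>S\<close>.\<close>

lemma Ck_on_partial_deriv:
  assumes "Ck_on (Suc k) S f" "e \<in> Basis" "open_along e S"
  shows "Ck_on k S (partial_deriv e f)"
    and "p \<in> S \<Longrightarrow> has_partial f e (partial_deriv e f p) p"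
proof -
  obtain f' where f':
    "\<forall>x\<in>S. (f has_derivative f' x) (at x within S)" "\<forall>i\<in>Basis. Ck_on k S (\<lambda>x. f' x i)"
    using assms by auto
  have *: "has_partial f e (f' p e) p" if "p \<in> S" for p
    using has_derivative_imp_has_partial f'(1) assms(3) that by blast
  show "Ck_on k S (partial_deriv e f)"
    using f' assms(2) by (auto intro: Ck_on_cong simp: has_partial_imp_eq[OF *])
  show "p \<in> S \<Longrightarrow> has_partial f e (partial_deriv e f p) p"
    using * partial_deriv_works by blast
qed

lemma smooth_on_partial_deriv:
  "smooth_on S f \<Longrightarrow> e \<in> Basis \<Longrightarrow> open_along e S \<Longrightarrow> smooth_on S (partial_deriv e f)"
  unfolding smooth_on_def by (blast intro: Ck_on_partial_deriv)

lemma smooth_on_has_partial: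
  "smooth_on S f \<Longrightarrow> e \<in> Basis \<Longrightarrow> open_along e S \<Longrightarrow> p \<in> S \<Longrightarrow>
    has_partial f e (partial_deriv e f p) p"
  unfolding smooth_on_def by (blast intro: Ck_on_partial_deriv)

lemma smooth_on_subset: "smooth_on S f \<Longrightarrow> T \<subseteq> S \<Longrightarrow> smooth_on T f"
  unfolding smooth_on_def by (blast intro: Ck_on_subset)

lemma smooth_on_ln: "smooth_on S f \<Longrightarrow> (\<And>x. x \<in> S \<Longrightarrow> f x > 0) \<Longrightarrow> smooth_on S (\<lambda>x. ln (f x))"
  unfolding smooth_on_def by (blast intro: Ck_on_ln)

lemma smooth_on_imp_continuous_on: "smooth_on S f \<Longrightarrow> continuous_on S f"
  unfolding smooth_on_def using Ck_on_imp_continuous_on by blast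

lemma has_partial_cong:
  assumes "has_partial f e D p" "open_along e S" "p \<in> S" "\<And>q. q \<in> S \<Longrightarrow> g q = f q"
  shows "has_partial g e D p"
proof -
  have "\<forall>\<^sub>F s in nhds (0::real). f (p + s *\<^sub>R e) = g (p + s *\<^sub>R e)"
    using assms by (auto simp: open_along_def elim!: eventually_mono)
  then show ?thesis
    using assms(1) unfolding has_partial_def by (subst (asm) DERIV_cong_ev) auto
qed

lemma partial_deriv_cong:
  assumes "open_along e S" "p \<in> S" "\<And>q. q \<in> S \<Longrightarrow> g q = f q"
  shows "partial_deriv e g p = partial_deriv e f p"
  unfolding partial_deriv_def
  using assms by (intro deriv_cong_ev) (auto simp: open_along_def elim!: eventually_mono)

text \<open>Shifting the base point along \<open>e\<close> makes one-variable theorems applicable on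
  whole segments.\<close>

lemma has_partial_line:
  "has_partial f e D (p + s *\<^sub>R e) \<longleftrightarrow> ((\<lambda>r. f (p + r *\<^sub>R e)) has_real_derivative D) (at s)"
proof -
  have "(\<lambda>r. f (p + s *\<^sub>R e + r *\<^sub>R e)) = (\<lambda>r. f (p + (r + s) *\<^sub>R e))"
    by (simp add: algebra_simps)
  then show ?thesis
    using DERIV_shift[of "\<lambda>r. f (p + r *\<^sub>R e)" D 0 s] by (simp add: has_partial_def)
qed

subsection \<open>Symmetry of second partial derivatives and the second derivative test\<close>

text \<open>The mean value theorem is used twice: along \<open>a\<close> for the difference of
  \<open>f\<close> on two parallel segments, then along \<open>b\<close> for \<open>fa\<close>. The
  unit vectors keep all points within \<open>2 * h\<close> of \<open>p\<close>.\<close>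

lemma mixed_difference_mvt:
  fixes f :: "'a::real_normed_vector \<Rightarrow> real"
  assumes "norm a = 1" "norm b = 1" "0 < h" "2 * h < r"
    and fa: "\<And>q. q \<in> ball p r \<Longrightarrow> has_partial f a (fa q) q"
    and fab: "\<And>q. q \<in> ball p r \<Longrightarrow> has_partial fa b (fab q) q"
  shows "\<exists>q. dist p q < 2 * h \<and>
    f (p + h *\<^sub>R a + h *\<^sub>R b) - f (p + h *\<^sub>R a) - f (p + h *\<^sub>R b) + f p = h * h * fab q"
proof -
  have near: "dist p (p + s *\<^sub>R a + t *\<^sub>R b) \<le> s + t" if "0 \<le> s" "0 \<le> t" for s t
  proof -
    have "dist p (p + s *\<^sub>R a + t *\<^sub>R b) = norm (s *\<^sub>R a + t *\<^sub>R b)"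
      by (metis add.assoc add_diff_cancel_left' dist_commute dist_norm)
    then show ?thesis
      using norm_triangle_ineq[of "s *\<^sub>R a" "t *\<^sub>R b"] that assms(1,2) by simp
  qed
  have D: "((\<lambda>s. f (p + h *\<^sub>R b + s *\<^sub>R a) - f (p + s *\<^sub>R a)) has_real_derivative
      fa (p + h *\<^sub>R b + s *\<^sub>R a) - fa (p + s *\<^sub>R a)) (at s)" if "0 \<le> s" "s \<le> h" for s
    using near[of s h] near[of s 0] that assms
    by (intro DERIV_diff; subst has_partial_line[symmetric]; intro fa) (auto simp: algebra_simps)
  obtain s where s: "0 < s" "s < h"
    "f (p + h *\<^sub>R b + h *\<^sub>R a) - f (p + h *\<^sub>R a) - (f (p + h *\<^sub>R b) - f p)
      = h * (fa (p + h *\<^sub>R b + s *\<^sub>R a) - fa (p + s *\<^sub>R a))"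
    using MVT2[OF \<open>0 < h\<close> D] by auto
  have D: "((\<lambda>t. fa (p + s *\<^sub>R a + t *\<^sub>R b)) has_real_derivative fab (p + s *\<^sub>R a + t *\<^sub>R b)) (at t)"
    if "0 \<le> t" "t \<le> h" for t
    using near[of s t] that s assms by (subst has_partial_line[symmetric]; intro fab) auto
  obtain t where t: "0 < t" "t < h"
    "fa (p + s *\<^sub>R a + h *\<^sub>R b) - fa (p + s *\<^sub>R a) = h * fab (p + s *\<^sub>R a + t *\<^sub>R b)"
    using MVT2[OF \<open>0 < h\<close> D] by auto
  show ?thesis
    using s t near[of s t] by (intro exI[of _ "p + s *\<^sub>R a + t *\<^sub>R b"]) (auto simp: algebra_simps)
qed

text \<open>The second difference is symmetric in \<open>a\<close> and \<open>b\<close>, so the two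
  mixed partials take a common value at two points near \<open>p\<close>; continuity excludes a gap
  at \<open>p\<close>.\<close>

lemma mixed_partials_commute:
  fixes f :: "'a::euclidean_space \<Rightarrow> real"
  assumes f: "smooth_on S f" and S: "open S" "p \<in> S" and e: "a \<in> Basis" "b \<in> Basis"
  shows "partial_deriv a (partial_deriv b f) p = partial_deriv b (partial_deriv a f) p"
proof (rule ccontr)
  let ?ab = "partial_deriv a (partial_deriv b f)" and ?ba = "partial_deriv b (partial_deriv a f)"
  assume ne: "?ab p \<noteq> ?ba p"
  note oa = open_imp_open_along[OF S(1)]
  note sm = smooth_on_partial_deriv[OF _ _ oa] smooth_on_has_partial[OF _ _ oa]
  \<comment> \<open>Half the gap: two errors below this cannot bridge it.\<close>
  define \<epsilon> where "\<epsilon> = \<bar>?ab p - ?ba p\<bar> / 2"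
  have "\<epsilon> > 0" using ne by (simp add: \<epsilon>_def)
  have "continuous_on S ?ab" "continuous_on S ?ba"
    using sm f e smooth_on_imp_continuous_on by blast+
  then have "isCont ?ab p" "isCont ?ba p"
    using S continuous_on_eq_continuous_at by blast+
  then obtain d1 d2 where d: "d1 > 0" "d2 > 0"
    "\<And>q. dist q p < d1 \<Longrightarrow> dist (?ab q) (?ab p) < \<epsilon>"
    "\<And>q. dist q p < d2 \<Longrightarrow> dist (?ba q) (?ba p) < \<epsilon>"
    using \<open>\<epsilon> > 0\<close> unfolding continuous_at_eps_delta by metis
  obtain r where r: "r > 0" "ball p r \<subseteq> S" using S open_contains_ball by blast
  define h where "h = Min {d1, d2, r} / 3"
  have h: "0 < h" "2 * h < r" "2 * h < d1" "2 * h < d2" using d r by (auto simp: h_def)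
  obtain q where q: "dist p q < 2 * h"
    "f (p + h *\<^sub>R a + h *\<^sub>R b) - f (p + h *\<^sub>R a) - f (p + h *\<^sub>R b) + f p = h * h * ?ba q"
    using mixed_difference_mvt[OF _ _ h(1,2), of a b p f "partial_deriv a f" ?ba] sm f e r
    by (auto simp: subset_iff)
  obtain q' where q': "dist p q' < 2 * h"
    "f (p + h *\<^sub>R b + h *\<^sub>R a) - f (p + h *\<^sub>R b) - f (p + h *\<^sub>R a) + f p = h * h * ?ab q'"
    using mixed_difference_mvt[OF _ _ h(1,2), of b a p f "partial_deriv b f" ?ab] sm f e r
    by (auto simp: subset_iff)
  have "h * h * ?ba q = h * h * ?ab q'" using q q' by (simp add: algebra_simps)
  then have "?ba q = ?ab q'" using h by simp
  moreover have "\<bar>?ba q - ?ba p\<bar> < \<epsilon>" "\<bar>?ab q' - ?ab p\<bar> < \<epsilon>"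
    using d(4)[of q] d(3)[of q'] q q' h by (auto simp: dist_commute dist_real_def)
  ultimately show False unfolding \<epsilon>_def by (simp add: abs_if split: if_splits)
qed

text \<open>If \<open>D\<close> were positive, \<open>g'\<close> would vanish at \<open>a\<close>
  and be positive just to its right, so the mean value theorem would make \<open>g\<close> exceed
  \<open>g a\<close>.\<close>

lemma has_real_derivative_local_max_second:
  fixes g g' :: "real \<Rightarrow> real"
  assumes "\<forall>\<^sub>F s in nhds a. g s \<le> g a"
    and "\<forall>\<^sub>F s in nhds a. (g has_real_derivative g' s) (at s)"
    and g'': "(g' has_real_derivative D) (at a)"
  shows "g' a = 0" "D \<le> 0"
proof -
  obtain d where d: "d > 0" "\<And>s. dist s a < d \<Longrightarrow> g s \<le> g a \<and> (g has_real_derivative g' s) (at s)"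
    using eventually_conj[OF assms(1,2)] unfolding eventually_nhds_metric by blast
  show 0: "g' a = 0"
    using d by (intro DERIV_local_max[of g "g' a" a d]) (auto simp: dist_real_def abs_minus_commute)
  show "D \<le> 0"
  proof (rule ccontr)
    assume "\<not> D \<le> 0"
    then obtain d' where d': "d' > 0" "\<And>h. 0 < h \<Longrightarrow> h < d' \<Longrightarrow> g' (a + h) > 0"
      using DERIV_pos_inc_right[OF g''] 0 by auto
    define h where "h = min d d' / 2"
    have h: "h > 0" "h < d" "h < d'" using d d' by (auto simp: h_def)
    obtain z where z: "a < z" "z < a + h" "g (a + h) - g a = h * g' z"
      using MVT2[of a "a + h" g g'] d h by (auto simp: dist_real_def)
    have "h * g' z > 0" using d'(2)[of "z - a"] z h by auto
    moreover have "g (a + h) \<le> g a" using d(2)[of "a + h"] h by (auto simp: dist_real_def)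
    ultimately show False using z by linarith
  qed
qed

subsection \<open>The maximum principle for the logarithm of the flow\<close>

text \<open>The algebra at a maximum point of \<open>\<rho>\<^sup>2 * F\<close>. Here
  \<open>A\<close> stands for \<open>1/u\<close>, \<open>V\<close> for \<open>v\<close>, and indexed
  letters for partial derivatives; \<open>grad\<close> and \<open>hess\<close> are the first and
  second order conditions expanded by the product rule.\<close>

lemma local_max_estimate:
  fixes A V t q f1 f2 x1 x2 \<rho> F F1 F2 F11 F22 Ft C :: real
  assumes A: "0 \<le> A" "A \<le> 1" and t: "0 \<le> t" "t \<le> 1 / 2" "t * V \<le> 1 / 8"
    and \<rho>: "0 < \<rho>" "\<rho> = 9 / 64 - (x1\<^sup>2 + x2\<^sup>2)"
    and G: "G = A * (f1\<^sup>2 + f2\<^sup>2)" "G \<le> C" and F: "F = t * Q + G"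
    and evol: "Ft - A * (F11 + F22) - 2 * A * (f1 * F1 + f2 * F2)
      \<le> Q + 2 * t * V * Q\<^sup>2 - (Q + G)\<^sup>2"
    and grad: "- 4 * x1 * \<rho> * F + \<rho>\<^sup>2 * F1 = 0" "- 4 * x2 * \<rho> * F + \<rho>\<^sup>2 * F2 = 0"
    and hess: "(8 * x1\<^sup>2 - 4 * \<rho>) * F + 2 * (- 4 * x1 * \<rho>) * F1 + \<rho>\<^sup>2 * F11 \<le> 0"
      "(8 * x2\<^sup>2 - 4 * \<rho>) * F + 2 * (- 4 * x2 * \<rho>) * F2 + \<rho>\<^sup>2 * F22 \<le> 0"
    and time: "0 \<le> Ft"
  shows "\<rho>\<^sup>2 * F \<le> 11 + 20 * C + 2 * C\<^sup>2"
proof -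
  define X where "X = x1\<^sup>2 + x2\<^sup>2"
  have X: "0 \<le> X" "X \<le> 9 / 64" using \<rho> by (auto simp: X_def)
  have \<rho>1: "\<rho> \<le> 9 / 64" "\<rho>\<^sup>2 \<le> 1" using \<rho> X power_le_one[of \<rho> 2] unfolding X_def by linarith+
  have C0: "0 \<le> G" "0 \<le> C" using A G by (auto intro: order_trans[of 0 G])
  show ?thesis
  proof (cases "0 \<le> Q")
    \<comment> \<open>For negative \<open>Q\<close> the function \<open>F\<close> is at most
      \<open>G\<close>, which is bounded by \<open>C\<close>.\<close>
    case False
    then have "F \<le> C" using F G t mult_nonneg_nonpos[of t Q] by auto
    then have "\<rho>\<^sup>2 * F \<le> 1 * C"
      using \<rho>1 C0
      by (meson mult_mono' mult_left_mono mult_right_mono order_trans zero_le_power2)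
    then show ?thesis using C0 zero_le_power2[of C] by linarith
  next
    case True
    have Fn: "0 \<le> F" using F True t C0 by simp
    \<comment> \<open>The vanishing gradient expresses \<open>F1\<close> and \<open>F2\<close>
      through \<open>F\<close>; the cross terms in \<open>hess\<close> then become multiples of
      \<open>F\<close>.\<close>
    have g: "\<rho> * F1 = 4 * x1 * F" "\<rho> * F2 = 4 * x2 * F"
      using grad \<rho>(1) by (auto simp: power2_eq_square algebra_simps)
    have h1: "\<rho>\<^sup>2 * F11 \<le> (4 * \<rho> + 24 * x1\<^sup>2) * F"
    proof -
      have "2 * (- 4 * x1 * \<rho>) * F1 = - 8 * x1 * (\<rho> * F1)" by simp
      also have "\<dots> = - 32 * x1\<^sup>2 * F" unfolding g by (simp add: power2_eq_square)
      finally show ?thesis using hess(1) by (simp add: algebra_simps)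
    qed
    have h2: "\<rho>\<^sup>2 * F22 \<le> (4 * \<rho> + 24 * x2\<^sup>2) * F"
    proof -
      have "2 * (- 4 * x2 * \<rho>) * F2 = - 8 * x2 * (\<rho> * F2)" by simp
      also have "\<dots> = - 32 * x2\<^sup>2 * F" unfolding g by (simp add: power2_eq_square)
      finally show ?thesis using hess(2) by (simp add: algebra_simps)
    qed
    have "A * (\<rho>\<^sup>2 * F11 + \<rho>\<^sup>2 * F22) \<le> A * ((8 * \<rho> + 24 * X) * F)"
      using h1 h2 A by (intro mult_left_mono) (auto simp: X_def algebra_simps)
    also have "\<dots> \<le> 1 * (8 * F)"
    proof (intro mult_mono mult_right_mono)
      show "8 * \<rho> + 24 * X \<le> 8" using \<rho>1 X by linarith
    qed (use A Fn \<rho> X in auto)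
    finally have a: "A * (\<rho>\<^sup>2 * F11 + \<rho>\<^sup>2 * F22) \<le> 8 * F" by simp
    \<comment> \<open>Young's inequality for the drift term: after multiplication by
      \<open>A\<close> the squares of \<open>f1\<close> and \<open>f2\<close> add up to
      \<open>G\<close>, which is at most \<open>C\<close>.\<close>
    have "2 * (f1 * x1 + f2 * x2) \<le> f1\<^sup>2 + f2\<^sup>2 + X"
      using sum_squares_bound[of f1 x1] sum_squares_bound[of f2 x2] by (simp add: X_def)
    then have "A * (2 * (f1 * x1 + f2 * x2)) \<le> A * (f1\<^sup>2 + f2\<^sup>2 + X)"
      using A by (intro mult_left_mono) auto
    also have "\<dots> = G + A * X" using G by (simp add: distrib_left)
    also have "\<dots> \<le> C + 1 * X" using A G X by (intro add_mono mult_right_mono) auto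
    finally have "4 * \<rho> * (A * (2 * (f1 * x1 + f2 * x2))) \<le> 4 * \<rho> * (C + X)"
      using \<rho> by (intro mult_left_mono) auto
    also have "\<dots> \<le> 1 * (C + 1)"
    proof (intro mult_mono)
      show "4 * \<rho> \<le> 1" using \<rho>1 by linarith
    qed (use X C0 in auto)
    finally have "4 * \<rho> * (A * (2 * (f1 * x1 + f2 * x2))) * F \<le> (C + 1) * F"
      using Fn by (intro mult_right_mono) auto
    moreover have "\<rho>\<^sup>2 * (2 * A * (f1 * F1 + f2 * F2)) = 4 * \<rho> * (A * (2 * (f1 * x1 + f2 * x2))) * F"
    proof -
      have "\<rho>\<^sup>2 * (2 * A * (f1 * F1 + f2 * F2)) = 2 * A * \<rho> * (f1 * (\<rho> * F1) + f2 * (\<rho> * F2))"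
        by (simp add: power2_eq_square algebra_simps)
      then show ?thesis unfolding g by (simp add: algebra_simps)
    qed
    ultimately have b: "\<rho>\<^sup>2 * (2 * A * (f1 * F1 + f2 * F2)) \<le> (C + 1) * F" by linarith
    \<comment> \<open>The reaction term costs a quarter of \<open>Q\<^sup>2\<close>, and the Bochner
      term supplies a full \<open>Q\<^sup>2\<close>; three quarters remain.\<close>
    have "2 * t * V * Q\<^sup>2 \<le> 1 / 4 * Q\<^sup>2" using t by (intro mult_right_mono) auto
    moreover have "Q\<^sup>2 \<le> (Q + G)\<^sup>2" using True C0 by (intro power_mono) auto
    ultimately have "Ft - A * (F11 + F22) - 2 * A * (f1 * F1 + f2 * F2) \<le> Q - 3 / 4 * Q\<^sup>2"
      using evol by linarith
    then have "0 \<le> A * (F11 + F22) + 2 * A * (f1 * F1 + f2 * F2) + Q - 3 / 4 * Q\<^sup>2"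
      using time by linarith
    then have "0 \<le> \<rho>\<^sup>2 * (A * (F11 + F22) + 2 * A * (f1 * F1 + f2 * F2) + Q - 3 / 4 * Q\<^sup>2)"
      by simp
    also have "\<dots> \<le> (C + 9) * F + \<rho>\<^sup>2 * Q - 3 / 4 * (\<rho>\<^sup>2 * Q\<^sup>2)"
      using a b by (simp add: algebra_simps)
    finally have "0 \<le> (C + 9) * F + \<rho>\<^sup>2 * Q - 3 / 4 * (\<rho>\<^sup>2 * Q\<^sup>2)" .
    \<comment> \<open>A second factor \<open>\<rho>\<^sup>2\<close> leaves only the localized
      quantities \<open>\<rho>\<^sup>2 * F\<close> and \<open>\<rho>\<^sup>2 * Q\<close>, up to one
      bounded factor.\<close>
    then have "0 \<le> \<rho>\<^sup>2 * ((C + 9) * F + \<rho>\<^sup>2 * Q - 3 / 4 * (\<rho>\<^sup>2 * Q\<^sup>2))" by simp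
    also have "\<dots> = (C + 9) * (\<rho>\<^sup>2 * F) + \<rho>\<^sup>2 * (\<rho>\<^sup>2 * Q) - 3 / 4 * (\<rho>\<^sup>2 * Q)\<^sup>2"
      by (simp add: power2_eq_square algebra_simps)
    finally have main: "3 / 4 * (\<rho>\<^sup>2 * Q)\<^sup>2 \<le> (C + 9) * (\<rho>\<^sup>2 * F) + \<rho>\<^sup>2 * (\<rho>\<^sup>2 * Q)" by simp
    define y where "y = \<rho>\<^sup>2 * Q"
    have y: "0 \<le> y" using True by (simp add: y_def)
    have "t * y \<le> 1 / 2 * y" using t y by (intro mult_right_mono) auto
    moreover have "\<rho>\<^sup>2 * G \<le> 1 * C" using \<rho>1 G C0 by (intro mult_mono) auto
    ultimately have Fy: "\<rho>\<^sup>2 * F \<le> y / 2 + C" by (simp add: F y_def algebra_simps)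
    have "(C + 9) * (\<rho>\<^sup>2 * F) \<le> (C + 9) * (y / 2 + C)" using Fy C0 by (intro mult_left_mono) auto
    moreover have "\<rho>\<^sup>2 * y \<le> 1 * y" using \<rho>1 y by (intro mult_right_mono) auto
    ultimately have q: "3 / 4 * y\<^sup>2 \<le> (C + 9) * (y / 2 + C) + y"
      using main by (simp add: y_def)
    \<comment> \<open>The quadratic inequality \<open>q\<close> bounds \<open>y\<close>: when
      \<open>y\<close> exceeds 1, its constant term is absorbed into the linear one and a factor
      \<open>y\<close> cancels.\<close>
    have "y \<le> 1 + (4 / 3) * ((C + 9) * (1 / 2 + C) + 1)"
    proof (cases "y \<le> 1")
      case True
      then show ?thesis using C0 by (simp add: add_increasing2)
    next
      case False
      have "(C + 9) * C * 1 \<le> (C + 9) * C * y" using False C0 by (intro mult_left_mono) auto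
      then have "3 / 4 * y * y \<le> ((C + 9) * (1 / 2 + C) + 1) * y"
        using q by (simp add: power2_eq_square algebra_simps)
      then have "3 / 4 * y \<le> (C + 9) * (1 / 2 + C) + 1" using False by simp
      then show ?thesis by (simp add: field_simps)
    qed
    then have "y \<le> 25 / 3 + 4 / 3 * C\<^sup>2 + 38 / 3 * C"
      by (simp add: power2_eq_square algebra_simps)
    then have "y / 2 + C \<le> 11 + 20 * C + 2 * C\<^sup>2"
      using C0 zero_le_power2[of C] by linarith
    then show ?thesis using Fy by simp
  qed
qed

text \<open>For \<open>v = exp f\<close> one has
  \<open>\<Delta>v / v = \<Delta>f + |\<nabla>f|^2\<close>, so \<open>flow\<close> is the given
  equation divided by \<open>v\<close>. Time is one of the coordinates, hence time and space
  derivatives commute on the open set.\<close>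

locale log_flow =
  fixes f :: "(real ^ 2) \<times> real \<Rightarrow> real" and \<Omega>
  assumes open_\<Omega>: "open \<Omega>" and smooth: "smooth_on \<Omega> f"
    and flow: "\<And>p. p \<in> \<Omega> \<Longrightarrow> partial_deriv (0, 1) f p = exp (- 2 * exp (f p)) *
      (partial_deriv (axis 1 1, 0) (partial_deriv (axis 1 1, 0) f) p
       + partial_deriv (axis 2 1, 0) (partial_deriv (axis 2 1, 0) f) p
       + (partial_deriv (axis 1 1, 0) f p)\<^sup>2 + (partial_deriv (axis 2 1, 0) f p)\<^sup>2)"
begin

abbreviation "e1 \<equiv> (axis 1 1, 0) :: (real ^ 2) \<times> real"
abbreviation "e2 \<equiv> (axis 2 1, 0) :: (real ^ 2) \<times> real"
abbreviation "e3 \<equiv> (0, 1) :: (real ^ 2) \<times> real"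
abbreviation "pd \<equiv> partial_deriv"
abbreviation "f1 \<equiv> pd e1 f"
abbreviation "f2 \<equiv> pd e2 f"

text \<open>The inverse conformal factor \<open>1/u\<close>.\<close>

definition "A p = exp (- 2 * exp (f p))"
text \<open>\<open>R\<close> equals \<open>\<partial>\<^sub>t f\<close>, but only involves spatial derivatives, so that it makes sense and is
  continuous up to the two ends of the time interval.\<close>

definition "P p = pd e1 f1 p + pd e2 f2 p + (f1 p)\<^sup>2 + (f2 p)\<^sup>2"
definition "R p = A p * P p"
definition "G p = A p * ((f1 p)\<^sup>2 + (f2 p)\<^sup>2)"
text \<open>Derivatives of \<open>G\<close> are spelled out in derivatives of \<open>f\<close>, so
  that Bochner's formula becomes a polynomial identity.\<close>

definition "G' e p = A p * (2 * f1 p * pd e f1 p + 2 * f2 p * pd e f2 p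
   - 2 * exp (f p) * pd e f p * ((f1 p)\<^sup>2 + (f2 p)\<^sup>2))"
definition "G'' e p = A p * (2 * (pd e f1 p)\<^sup>2 + 2 * f1 p * pd e (pd e f1) p
   + 2 * (pd e f2 p)\<^sup>2 + 2 * f2 p * pd e (pd e f2) p
   - 4 * exp (f p) * pd e f p * (2 * f1 p * pd e f1 p + 2 * f2 p * pd e f2 p)
   + (4 * (exp (f p))\<^sup>2 * (pd e f p)\<^sup>2 - 2 * exp (f p) * (pd e f p)\<^sup>2 - 2 * exp (f p) * pd e (pd e f) p)
     * ((f1 p)\<^sup>2 + (f2 p)\<^sup>2))"
definition "P' e p = pd e (pd e1 f1) p + pd e (pd e2 f2) p
   + 2 * f1 p * pd e f1 p + 2 * f2 p * pd e f2 p"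

lemma Basis_e [simp]: "e1 \<in> Basis" "e2 \<in> Basis" "e3 \<in> Basis"
  by (auto simp: Basis_prod_def axis_in_Basis_iff)

lemma smooth_partial: "smooth_on \<Omega> g \<Longrightarrow> e \<in> Basis \<Longrightarrow> smooth_on \<Omega> (pd e g)"
  by (intro smooth_on_partial_deriv open_imp_open_along open_\<Omega>)

lemma DERIV_line:
  "smooth_on \<Omega> g \<Longrightarrow> e \<in> Basis \<Longrightarrow> p \<in> \<Omega> \<Longrightarrow>
    ((\<lambda>s. g (p + s *\<^sub>R e)) has_real_derivative pd e g p) (at 0)"
  using smooth_on_has_partial[OF _ _ open_imp_open_along[OF open_\<Omega>]] by (auto simp: has_partial_def)

lemma partial_commute:
  "smooth_on \<Omega> g \<Longrightarrow> a \<in> Basis \<Longrightarrow> b \<in> Basis \<Longrightarrow> p \<in> \<Omega> \<Longrightarrow> pd a (pd b g) p = pd b (pd a g) p"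
  using mixed_partials_commute[OF _ open_\<Omega>] by blast

lemma partial_commute3:
  assumes g: "smooth_on \<Omega> g" and e: "a \<in> Basis" "b \<in> Basis" "c \<in> Basis" "p \<in> \<Omega>"
  shows "pd a (pd b (pd c g)) p = pd b (pd c (pd a g)) p"
proof -
  have "pd a (pd b (pd c g)) p = pd b (pd a (pd c g)) p"
    using assms by (intro partial_commute smooth_partial)
  \<comment> \<open>The inner exchange holds throughout the open set and may therefore be
    differentiated.\<close>
  also have "\<dots> = pd b (pd c (pd a g)) p"
    using assms open_imp_open_along[OF open_\<Omega>]
    by (intro partial_deriv_cong[of _ \<Omega>] partial_commute) auto
  finally show ?thesis .
qed

lemma flow_R: "p \<in> \<Omega> \<Longrightarrow> pd e3 f p = R p"
  using flow by (simp add: R_def A_def P_def add.assoc)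

text \<open>On the open set \<open>R\<close> is a partial derivative of \<open>f\<close>.\<close>

lemma smooth_R: "smooth_on \<Omega> R"
  using smooth_partial[OF smooth Basis_e(3)] Ck_on_cong[of _ \<Omega> "pd e3 f" R] flow_R
  unfolding smooth_on_def by force

section \<open>Derivatives and evolution equations of \<open>R\<close> and \<open>G\<close>\<close>

lemma partial_G:
  assumes "e \<in> Basis" "p \<in> \<Omega>"
  shows "has_partial G e (G' e p) p"
proof -
  note D = DERIV_line[OF smooth assms] DERIV_line[OF smooth_partial[OF smooth Basis_e(1)] assms]
    DERIV_line[OF smooth_partial[OF smooth Basis_e(2)] assms]
  show ?thesis
    unfolding has_partial_def G_def A_def
    by (rule derivative_eq_intros D refl)+ (simp add: G'_def A_def algebra_simps power2_eq_square)
qed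

lemma partial_G':
  assumes "e \<in> Basis" "p \<in> \<Omega>"
  shows "has_partial (G' e) e (G'' e p) p"
proof -
  note D = DERIV_line[OF smooth assms] DERIV_line[OF smooth_partial[OF smooth Basis_e(1)] assms]
    DERIV_line[OF smooth_partial[OF smooth Basis_e(2)] assms]
    DERIV_line[OF smooth_partial[OF smooth assms(1)] assms]
    DERIV_line[OF smooth_partial[OF smooth_partial[OF smooth Basis_e(1)] assms(1)] assms]
    DERIV_line[OF smooth_partial[OF smooth_partial[OF smooth Basis_e(2)] assms(1)] assms]
  show ?thesis
    unfolding has_partial_def G'_def A_def
    by (rule derivative_eq_intros D refl)+ (simp add: G''_def A_def algebra_simps power2_eq_square)
qed

lemma partial_R:
  assumes "e \<in> Basis" "p \<in> \<Omega>"
  shows "pd e R p = A p * (P' e p - 2 * exp (f p) * pd e f p * P p)"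
proof -
  note sm = smooth_partial[OF smooth Basis_e(1)] smooth_partial[OF smooth Basis_e(2)]
  note D = DERIV_line[OF smooth assms] DERIV_line[OF sm(1) assms] DERIV_line[OF sm(2) assms]
    DERIV_line[OF smooth_partial[OF sm(1) Basis_e(1)] assms]
    DERIV_line[OF smooth_partial[OF sm(2) Basis_e(2)] assms]
  have "has_partial R e (A p * (P' e p - 2 * exp (f p) * pd e f p * P p)) p"
    unfolding has_partial_def R_def A_def P_def
    by (rule derivative_eq_intros D refl)+ (simp add: P'_def algebra_simps power2_eq_square)
  then show ?thesis by (rule has_partial_imp_eq)
qed

lemma partial_R_cong:
  assumes "e \<in> Basis" "p \<in> \<Omega>"
  shows "pd e R p = pd e (pd e3 f) p"
  using assms open_imp_open_along[OF open_\<Omega>] flow_R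
  by (intro partial_deriv_cong[of _ \<Omega>]) auto

text \<open>In the time derivative of \<open>A * P\<close>, each time derivative of \<open>f\<close>
  commutes inwards and becomes \<open>R\<close>; the quadratic term arises from differentiating
  \<open>A\<close>.\<close>

lemma R_evolution:
  assumes p: "p \<in> \<Omega>"
  shows "pd e3 R p = A p * (pd e1 (pd e1 R) p + pd e2 (pd e2 R) p)
    + 2 * A p * (f1 p * pd e1 R p + f2 p * pd e2 R p) - 2 * exp (f p) * (R p)\<^sup>2"
proof -
  have 2: "pd e3 (pd e f) p = pd e R p" if "e \<in> Basis" for e
    using partial_commute[OF smooth Basis_e(3) that p] partial_R_cong[OF that p] by simp
  have 3: "pd e3 (pd e (pd e f)) p = pd e (pd e R) p" if "e \<in> Basis" for e
  proof -
    have "pd e (pd e R) p = pd e (pd e (pd e3 f)) p"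
      by (rule partial_deriv_cong[OF open_imp_open_along[OF open_\<Omega>] p partial_R_cong[OF that]])
    then show ?thesis using partial_commute3[OF smooth Basis_e(3) that that p] by simp
  qed
  show ?thesis
    unfolding partial_R[OF Basis_e(3) p] P'_def 2[OF Basis_e(1)] 2[OF Basis_e(2)]
      3[OF Basis_e(1)] 3[OF Basis_e(2)] flow_R[OF p]
    by (simp add: R_def algebra_simps power2_eq_square)
qed

text \<open>Bochner's formula: the right-hand side is minus twice the squared norm of the Hessian of \<open>f\<close>
  with respect to the evolving metric, split into trace and trace-free parts.\<close>

lemma G_evolution:
  assumes p: "p \<in> \<Omega>"
  shows "G' e3 p - A p * (G'' e1 p + G'' e2 p) - 2 * A p * (f1 p * G' e1 p + f2 p * G' e2 p)
    = - (A p * (pd e1 f1 p + pd e2 f2 p))\<^sup>2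
      - (A p)\<^sup>2 * ((pd e1 f1 p - pd e2 f2 p - 2 * exp (f p) * ((f1 p)\<^sup>2 - (f2 p)\<^sup>2))\<^sup>2
        + 4 * (pd e1 f2 p - 2 * exp (f p) * f1 p * f2 p)\<^sup>2)"
proof -
  have 2: "pd e3 (pd e f) p = pd e R p" if "e \<in> Basis" for e
    using partial_commute[OF smooth Basis_e(3) that p] partial_R_cong[OF that p] by simp
  \<comment> \<open>These rewrites bring the third derivatives in \<open>G''\<close> to the form in
    which they occur in \<open>P'\<close>, where they cancel.\<close>
  have 3: "pd e1 (pd e1 f2) p = pd e2 (pd e1 f1) p" "pd e2 (pd e2 f1) p = pd e1 (pd e2 f2) p"
    "pd e2 f1 p = pd e1 f2 p"
    by (rule partial_commute3[symmetric] partial_commute smooth Basis_e p)+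
  show ?thesis
    unfolding G'_def G''_def 2[OF Basis_e(1)] 2[OF Basis_e(2)] partial_R[OF Basis_e(1) p]
      partial_R[OF Basis_e(2) p] P'_def P_def flow_R[OF p] R_def 3
    by algebra
qed

section \<open>The test function and its localization; here \<open>Q\<close> is
  \<open>- R\<close>\<close>

definition "F p = G p - snd p * R p"
text \<open>The factor \<open>t\<close> is not differentiated in \<open>F'\<close>, which therefore is the derivative of \<open>F\<close> only
  along spatial \<open>e\<close>.\<close>

definition "F' e p = G' e p - snd p * pd e R p"
definition "F'' e p = G'' e p - snd p * pd e (pd e R) p"
text \<open>The zero set is the circle of radius 3/8, between the discs of radius 1/4 and
  1/2.\<close>

definition \<rho> :: "(real ^ 2) \<times> real \<Rightarrow> real" where "\<rho> p = 9 / 64 - (norm (fst p))\<^sup>2"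
definition "H p = (\<rho> p)\<^sup>2 * F p"
text \<open>The product rule with \<open>- 2 * (fst p \<bullet> fst e)\<close> as derivative of the
  cutoff; \<open>H''\<close> also uses that the spatial direction is a unit vector.\<close>

definition "H' e p = - 4 * (fst p \<bullet> fst e) * \<rho> p * F p + (\<rho> p)\<^sup>2 * F' e p"
definition "H'' e p = (8 * (fst p \<bullet> fst e)\<^sup>2 - 4 * \<rho> p) * F p
   + 2 * (- 4 * (fst p \<bullet> fst e) * \<rho> p) * F' e p + (\<rho> p)\<^sup>2 * F'' e p"

lemma DERIV_\<rho>: "((\<lambda>s. \<rho> (p + s *\<^sub>R (b, 0))) has_real_derivative - 2 * (fst p \<bullet> b)) (at 0)"
proof -
  have "(\<lambda>s. \<rho> (p + s *\<^sub>R (b, 0))) =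
      (\<lambda>s. 9 / 64 - ((norm (fst p))\<^sup>2 + 2 * s * (fst p \<bullet> b) + s\<^sup>2 * (b \<bullet> b)))"
    by (simp add: \<rho>_def power2_norm_eq_inner inner_add_left inner_add_right fun_eq_iff)
      (simp add: inner_commute power2_eq_square algebra_simps)
  then show ?thesis by (auto intro!: derivative_eq_intros)
qed

lemma DERIV_snd: "((\<lambda>s. snd (p + s *\<^sub>R e)) has_real_derivative snd e) (at 0)"
  by (auto intro!: derivative_eq_intros)

lemma DERIV_inner_fst:
  "((\<lambda>s. fst (p + s *\<^sub>R e) \<bullet> b) has_real_derivative fst e \<bullet> b) (at 0)"
  by (auto simp: inner_add_left intro!: derivative_eq_intros)

text \<open>The correction \<open>snd e * R p\<close> is the contribution of the factor
  \<open>t\<close>.\<close>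

lemma DERIV_F:
  assumes "e \<in> Basis" "p \<in> \<Omega>"
  shows "((\<lambda>s. F (p + s *\<^sub>R e)) has_real_derivative F' e p - snd e * R p) (at 0)"
proof -
  note D = DERIV_line[OF smooth_R assms] partial_G[OF assms, unfolded has_partial_def] DERIV_snd
  show ?thesis
    unfolding F_def by (rule derivative_eq_intros D refl)+ (simp add: F'_def)
qed

lemma DERIV_F':
  assumes "e \<in> Basis" "snd e = 0" "p \<in> \<Omega>"
  shows "((\<lambda>s. F' e (p + s *\<^sub>R e)) has_real_derivative F'' e p) (at 0)"
proof -
  note D = DERIV_line[OF smooth_partial[OF smooth_R assms(1)] assms(1,3)]
    partial_G'[OF assms(1,3), unfolded has_partial_def] DERIV_snd
  show ?thesis
    unfolding F'_def by (rule derivative_eq_intros D refl)+ (simp add: F''_def assms)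
qed

lemma partial_H:
  assumes e: "(b, 0::real) \<in> Basis" "p \<in> \<Omega>"
  shows "has_partial H (b, 0) (H' (b, 0) p) p"
    and "has_partial (H' (b, 0)) (b, 0) (H'' (b, 0) p) p"
proof -
  have b: "b \<bullet> b = 1" using e(1) by (auto simp: Basis_prod_def)
  note D = DERIV_F[OF e] DERIV_F'[OF e(1) _ e(2)] DERIV_\<rho> DERIV_inner_fst
  show "has_partial H (b, 0) (H' (b, 0) p) p"
    unfolding has_partial_def H_def
    by (rule derivative_eq_intros D refl)+ (simp add: H'_def zero_prod_def[symmetric] algebra_simps power2_eq_square)
  show "has_partial (H' (b, 0)) (b, 0) (H'' (b, 0) p) p"
    unfolding has_partial_def H'_def
    by (rule derivative_eq_intros D refl | simp)+
      (simp add: H''_def b zero_prod_def[symmetric] algebra_simps power2_eq_square)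
qed

text \<open>The one-variable test on a coordinate line; pure second derivatives suffice because the
  operator involves only the Laplacian.\<close>

lemma spatial_max:
  assumes e: "(b, 0::real) \<in> Basis" "p \<in> \<Omega>" and max: "\<forall>\<^sub>F s in nhds 0. H (p + s *\<^sub>R (b, 0)) \<le> H p"
  shows "H' (b, 0) p = 0" "H'' (b, 0) p \<le> 0"
proof -
  have ev: "\<forall>\<^sub>F s in nhds 0. ((\<lambda>s. H (p + s *\<^sub>R (b, 0))) has_real_derivative
      H' (b, 0) (p + s *\<^sub>R (b, 0))) (at s)"
  proof -
    have "\<forall>\<^sub>F s in nhds (0::real). p + s *\<^sub>R (b, 0) \<in> \<Omega>"
      using open_imp_open_along[OF open_\<Omega>, of "(b, 0)"] e(2) unfolding open_along_def by blast
    then show ?thesis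
      by eventually_elim (subst has_partial_line[symmetric], rule partial_H[OF e(1)])
  qed
  have "\<forall>\<^sub>F s in nhds 0. H (p + s *\<^sub>R (b, 0)) \<le> H (p + 0 *\<^sub>R (b, 0))"
    using max by (simp add: zero_prod_def[symmetric])
  note has_real_derivative_local_max_second[OF this ev partial_H(2)[OF e, unfolded has_partial_def]]
  then show "H' (b, 0) p = 0" "H'' (b, 0) p \<le> 0" by (simp_all add: zero_prod_def[symmetric])
qed

text \<open>Combines both evolution equations; \<open>F' e3 p - R p\<close> is the full time
  derivative of \<open>F\<close>.\<close>

lemma F_evolution:
  assumes p: "p \<in> \<Omega>"
  shows "F' e3 p - R p - A p * (F'' e1 p + F'' e2 p) - 2 * A p * (f1 p * F' e1 p + f2 p * F' e2 p)
    \<le> - R p + 2 * snd p * exp (f p) * (R p)\<^sup>2 - (- R p + G p)\<^sup>2"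
proof -
  have "A p * (pd e1 f1 p + pd e2 f2 p) = R p - G p"
    by (simp add: R_def G_def P_def algebra_simps)
  \<comment> \<open>The trace-free part in Bochner's formula has a favourable sign and is
    dropped.\<close>
  then have G: "G' e3 p - A p * (G'' e1 p + G'' e2 p) - 2 * A p * (f1 p * G' e1 p + f2 p * G' e2 p)
      \<le> - (R p - G p)\<^sup>2"
    using G_evolution[OF p] by simp
  have "F' e3 p - R p - A p * (F'' e1 p + F'' e2 p) - 2 * A p * (f1 p * F' e1 p + f2 p * F' e2 p)
    = - R p + (G' e3 p - A p * (G'' e1 p + G'' e2 p) - 2 * A p * (f1 p * G' e1 p + f2 p * G' e2 p))
     + 2 * snd p * exp (f p) * (R p)\<^sup>2"
    unfolding F'_def F''_def R_evolution[OF p] by (simp add: algebra_simps)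
  also have "\<dots> \<le> - R p + - (R p - G p)\<^sup>2 + 2 * snd p * exp (f p) * (R p)\<^sup>2"
    using G by simp
  finally show ?thesis by (simp add: power2_commute)
qed

text \<open>In time only earlier points are compared, since the maximum may lie on the last time
  slice; this still gives the sign of the time derivative.\<close>

lemma interior_max_estimate:
  assumes p: "p \<in> \<Omega>" "0 < \<rho> p" "0 \<le> snd p" "snd p \<le> 1 / 2" "snd p * exp (f p) \<le> 1 / 8" "G p \<le> C"
    and max: "\<And>e. e \<in> {e1, e2} \<Longrightarrow> \<forall>\<^sub>F s in nhds 0. H (p + s *\<^sub>R e) \<le> H p"
      "\<forall>\<^sub>F s in at_left 0. H (p + s *\<^sub>R e3) \<le> H p"
  shows "H p \<le> 11 + 20 * C + 2 * C\<^sup>2"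
proof -
  have x: "fst p \<bullet> axis i 1 = fst p $ i" for i by (simp add: inner_axis)
  have \<rho>: "\<rho> p = 9 / 64 - ((fst p $ 1)\<^sup>2 + (fst p $ 2)\<^sup>2)"
    by (simp add: \<rho>_def power2_norm_eq_inner inner_vec_def sum_2) (simp add: power2_eq_square)
  have t: "0 \<le> F' e3 p - R p"
  proof (rule ccontr)
    assume "\<not> ?thesis"
    then obtain d where d: "d > 0" "\<And>h. 0 < h \<Longrightarrow> h < d \<Longrightarrow> F p < F (p + (- h) *\<^sub>R e3)"
      using DERIV_neg_dec_left[OF DERIV_F[OF Basis_e(3) p(1)]] by (auto simp: zero_prod_def[symmetric])
    obtain c where c: "c < 0" "\<And>s. c < s \<Longrightarrow> s < 0 \<Longrightarrow> H (p + s *\<^sub>R e3) \<le> H p"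
      using max(2) unfolding eventually_at_left_field by auto
    define h where "h = min d (- c) / 2"
    have h: "0 < h" "h < d" "- h > c" using d c by (auto simp: h_def)
    \<comment> \<open>The cutoff does not depend on time, so the comparison passes from
      \<open>H\<close> to \<open>F\<close>.\<close>
    have "\<rho> (p + (- h) *\<^sub>R e3) = \<rho> p" by (simp add: \<rho>_def)
    then have "F (p + (- h) *\<^sub>R e3) \<le> F p" using c(2)[of "- h"] h p(2) by (simp add: H_def)
    then show False using d(2)[of h] h by simp
  qed
  have "(\<rho> p)\<^sup>2 * F p \<le> 11 + 20 * C + 2 * C\<^sup>2"
  proof (rule local_max_estimate[where V = "exp (f p)" and t = "snd p" and Q = "- R p"])
    show "F' e3 p - R p - A p * (F'' e1 p + F'' e2 p) - 2 * A p * (f1 p * F' e1 p + f2 p * F' e2 p)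
      \<le> - R p + 2 * snd p * exp (f p) * (- R p)\<^sup>2 - (- R p + G p)\<^sup>2"
      using F_evolution[OF p(1)] by simp
    show "\<rho> p = 9 / 64 - ((fst p $ 1)\<^sup>2 + (fst p $ 2)\<^sup>2)" by (rule \<rho>)
    show "- 4 * fst p $ 1 * \<rho> p * F p + (\<rho> p)\<^sup>2 * F' e1 p = 0"
      using spatial_max(1)[OF Basis_e(1) p(1) max(1)] by (simp add: H'_def x)
    show "- 4 * fst p $ 2 * \<rho> p * F p + (\<rho> p)\<^sup>2 * F' e2 p = 0"
      using spatial_max(1)[OF Basis_e(2) p(1) max(1)] by (simp add: H'_def x)
    show "(8 * (fst p $ 1)\<^sup>2 - 4 * \<rho> p) * F p + 2 * (- 4 * fst p $ 1 * \<rho> p) * F' e1 p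
        + (\<rho> p)\<^sup>2 * F'' e1 p \<le> 0"
      using spatial_max(2)[OF Basis_e(1) p(1) max(1)] by (simp add: H''_def x)
    show "(8 * (fst p $ 2)\<^sup>2 - 4 * \<rho> p) * F p + 2 * (- 4 * fst p $ 2 * \<rho> p) * F' e2 p
        + (\<rho> p)\<^sup>2 * F'' e2 p \<le> 0"
      using spatial_max(2)[OF Basis_e(2) p(1) max(1)] by (simp add: H''_def x)
  qed (use p t in \<open>simp_all add: A_def G_def F_def\<close>)
  then show ?thesis by (simp add: H_def)
qed

end

subsection \<open>The curvature bound\<close>

text \<open>The formula for the first derivative holds on all of \<open>S\<close> and can be
  differentiated again because \<open>S\<close> is open along \<open>e\<close>.\<close>

lemma second_partial_deriv_exp:
  assumes f: "smooth_on S f" and e: "e \<in> Basis" "open_along e S" "p \<in> S"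
    and v: "\<And>q. q \<in> S \<Longrightarrow> v q = exp (f q)"
  shows "partial_deriv e (partial_deriv e v) p =
      exp (f p) * (partial_deriv e (partial_deriv e f) p + (partial_deriv e f p)\<^sup>2)"
proof -
  note D = smooth_on_has_partial[OF f e(1,2), unfolded has_partial_def]
    smooth_on_has_partial[OF smooth_on_partial_deriv[OF f e(1,2)] e(1,2), unfolded has_partial_def]
  have *: "partial_deriv e v q = exp (f q) * partial_deriv e f q" if "q \<in> S" for q
  proof (rule has_partial_imp_eq, rule has_partial_cong[OF _ e(2) that v])
    show "has_partial (\<lambda>q. exp (f q)) e (exp (f q) * partial_deriv e f q) q"
      unfolding has_partial_def by (rule derivative_eq_intros D refl that)+ simp
  qed
  show "partial_deriv e (partial_deriv e v) p =
      exp (f p) * (partial_deriv e (partial_deriv e f) p + (partial_deriv e f p)\<^sup>2)"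
  proof (rule has_partial_imp_eq, rule has_partial_cong[OF _ e(2,3) *])
    show "has_partial (\<lambda>q. exp (f q) * partial_deriv e f q) e
      (exp (f p) * (partial_deriv e (partial_deriv e f) p + (partial_deriv e f p)\<^sup>2)) p"
      unfolding has_partial_def
      by (rule derivative_eq_intros D refl e)+ (simp add: algebra_simps power2_eq_square)
  qed
qed

text \<open>Links the spatial operators of the definitions to directions in space-time.\<close>

lemma partial_deriv_slice:
  "partial_deriv i (\<lambda>y. g (y, t)) = (\<lambda>x. partial_deriv (i, 0) g (x, t))"
  by (simp add: partial_deriv_def fun_eq_iff)

lemma sum_Basis_vec2: "sum g (Basis :: (real ^ 2) set) = g (axis 1 1) + g (axis 2 1)"
proof -
  have B: "(Basis :: (real ^ 2) set) = {axis 1 1, axis 2 1}"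
    by (auto simp: Basis_vec_def) (metis exhaust_2)
  show ?thesis unfolding B by (subst sum.insert) (auto simp: axis_eq_axis)
qed

lemma norm_gradient_vec2:
  fixes g :: "real ^ 2 \<Rightarrow> real"
  shows "(norm (gradient g x))\<^sup>2 = (partial_deriv (axis 1 1) g x)\<^sup>2 + (partial_deriv (axis 2 1) g x)\<^sup>2"
  by (simp add: gradient_def sum_Basis_vec2 power2_norm_eq_inner inner_add_left inner_add_right
      inner_axis_axis) (simp add: power2_eq_square)

text \<open>The first factor of the constant bounds \<open>H\<close>; the factor
  \<open>(64 / 5)\<^sup>2\<close> comes from the lower bound 5/64 for the cutoff on the quarter
  disc.\<close>

lemma curvature_bound_interior:
  fixes v :: "(real ^ 2) \<times> real \<Rightarrow> real" and t\<^sub>0 C\<^sub>2 :: real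
  defines "S \<equiv> disc (1 / 2) \<times> {0..t\<^sub>0}"
  assumes t\<^sub>0: "0 < t\<^sub>0" "t\<^sub>0 < 1 / 2" and v: "smooth_on S v" "\<And>p. p \<in> S \<Longrightarrow> 1 \<le> v p"
    and flow: "conformal_ricci_flow_on (disc (1 / 2)) t\<^sub>0 v"
    and grad: "\<And>x t. (x, t) \<in> S \<Longrightarrow>
      conf_grad_norm_sq (\<lambda>y. exp (2 * v (y, t))) (\<lambda>y. ln (v (y, t))) x \<le> C\<^sub>2"
    and vt: "\<And>x t. (x, t) \<in> S \<Longrightarrow> t * v (x, t) \<le> 1 / 8"
    and x: "x \<in> disc (1 / 4)" and t: "0 < t" "t \<le> t\<^sub>0"
  shows "gauss_curvature (\<lambda>y. v (y, t)) x \<le> (11 + 20 * C\<^sub>2 + 2 * C\<^sub>2\<^sup>2) * (64 / 5)\<^sup>2 * v (x, t) / t"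
proof -
  define f where "f p = ln (v p)" for p
  have vf: "v p = exp (f p)" if "p \<in> S" for p using v(2)[OF that] by (simp add: f_def)
  have f: "smooth_on S f"
    unfolding f_def[abs_def] using v by (intro smooth_on_ln) force+
  let ?\<Omega> = "disc (1 / 2) \<times> {0<..<t\<^sub>0}"
  let ?e1 = "(axis 1 1, 0) :: (real ^ 2) \<times> real" and ?e2 = "(axis 2 1, 0) :: (real ^ 2) \<times> real"
  have \<Omega>S: "?\<Omega> \<subseteq> S" by (auto simp: S_def)
  have e: "?e1 \<in> Basis" "?e2 \<in> Basis" by (auto simp: Basis_prod_def axis_in_Basis_iff)
  have along: "open_along (b, 0) S" for b unfolding S_def by (intro open_along_Times) auto
  have lap: "laplacian (\<lambda>y. v (y, t)) x = v (x, t) *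
      (partial_deriv ?e1 (partial_deriv ?e1 f) (x, t) + partial_deriv ?e2 (partial_deriv ?e2 f) (x, t)
       + (partial_deriv ?e1 f (x, t))\<^sup>2 + (partial_deriv ?e2 f (x, t))\<^sup>2)"
    if "(x, t) \<in> S" for x t
  proof -
    have "laplacian (\<lambda>y. v (y, t)) x =
        partial_deriv ?e1 (partial_deriv ?e1 v) (x, t) + partial_deriv ?e2 (partial_deriv ?e2 v) (x, t)"
      by (simp add: laplacian_def sum_Basis_vec2 partial_deriv_slice)
    also have "\<dots> = exp (f (x, t)) *
        (partial_deriv ?e1 (partial_deriv ?e1 f) (x, t) + (partial_deriv ?e1 f (x, t))\<^sup>2)
      + exp (f (x, t)) *
        (partial_deriv ?e2 (partial_deriv ?e2 f) (x, t) + (partial_deriv ?e2 f (x, t))\<^sup>2)"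
      by (intro arg_cong2[of _ _ _ _ plus] second_partial_deriv_exp[OF f _ along that vf] e)
    finally show ?thesis by (simp add: vf[OF that] algebra_simps)
  qed
  interpret log_flow f ?\<Omega>
  proof
    show "open ?\<Omega>" by (intro open_Times) auto
    show "smooth_on ?\<Omega> f" using f \<Omega>S by (rule smooth_on_subset)
    fix p assume p: "p \<in> ?\<Omega>"
    obtain x t where xt: "p = (x, t)" by (cases p)
    have S: "(x, t) \<in> S" using p xt \<Omega>S by blast
    have "((\<lambda>s. v (x, s)) has_real_derivative exp (- 2 * v (x, t)) * laplacian (\<lambda>y. v (y, t)) x)
        (at t within {0..t\<^sub>0})"
      using flow p xt by (auto simp: conformal_ricci_flow_on_def)
    \<comment> \<open>Away from the ends of the time interval the one-sided derivative is
      two-sided.\<close>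
    moreover have "at t within {0..t\<^sub>0} = at t"
      using p xt by (intro at_within_interior) (simp add: interior_atLeastAtMost_real)
    ultimately have D: "((\<lambda>s. v (x, s)) has_real_derivative
        exp (- 2 * v (x, t)) * laplacian (\<lambda>y. v (y, t)) x) (at t)" by simp
    have "((\<lambda>s. f (x, s)) has_real_derivative
        exp (- 2 * v (x, t)) * laplacian (\<lambda>y. v (y, t)) x / v (x, t)) (at t)"
      unfolding f_def using v(2)[OF S] by (auto intro!: derivative_eq_intros D)
    then have "((\<lambda>s. f (x, t + s)) has_real_derivative
        exp (- 2 * v (x, t)) * laplacian (\<lambda>y. v (y, t)) x / v (x, t)) (at 0)"
      using DERIV_shift[of "\<lambda>s. f (x, s)" _ 0 t] by (simp add: add.commute)
    then have "has_partial f (0, 1) (exp (- 2 * v (x, t)) * laplacian (\<lambda>y. v (y, t)) x / v (x, t)) p"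
      by (simp add: has_partial_def xt)
    then show "partial_deriv (0, 1) f p = exp (- 2 * exp (f p)) *
      (partial_deriv ?e1 (partial_deriv ?e1 f) p + partial_deriv ?e2 (partial_deriv ?e2 f) p
       + (partial_deriv ?e1 f p)\<^sup>2 + (partial_deriv ?e2 f p)\<^sup>2)"
      using v(2)[OF S] by (simp add: has_partial_imp_eq lap[OF S] xt flip: vf[OF S])
  qed
  have GC: "G p \<le> C\<^sub>2" if "p \<in> S" for p
  proof -
    obtain x t where xt: "p = (x, t)" by (cases p)
    have "G p = conf_grad_norm_sq (\<lambda>y. exp (2 * v (y, t))) (\<lambda>y. ln (v (y, t))) x"
      using vf[OF that] by (simp add: G_def A_def conf_grad_norm_sq_def norm_gradient_vec2
          partial_deriv_slice xt exp_minus flip: f_def)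
    then show ?thesis using grad that xt by simp
  qed
  have sm: "smooth_on S (partial_deriv (b, 0) g)" if "smooth_on S g" "(b, 0::real) \<in> Basis" for b g
    using that along by (intro smooth_on_partial_deriv) auto
  have cont: "continuous_on S f" "continuous_on S f1" "continuous_on S f2"
    "continuous_on S (partial_deriv ?e1 f1)" "continuous_on S (partial_deriv ?e2 f2)"
    by (intro smooth_on_imp_continuous_on sm f e)+
  have contR: "continuous_on S R"
    unfolding R_def[abs_def] A_def P_def by (intro continuous_intros cont)
  have contH: "continuous_on S H"
    unfolding H_def[abs_def] F_def \<rho>_def G_def A_def
    by (intro continuous_intros cont contR)
  define B where "B = 11 + 20 * C\<^sub>2 + 2 * C\<^sub>2\<^sup>2"
  have G0: "0 \<le> G p" for p by (simp add: G_def A_def)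
  have "0 \<le> C\<^sub>2" using G0[of "(0, 0)"] GC[of "(0, 0)"] t\<^sub>0 by (simp add: S_def)
  then have BC: "0 \<le> B" "C\<^sub>2 \<le> B" using zero_le_power2[of C\<^sub>2] by (auto simp: B_def)
  \<comment> \<open>\<open>H\<close> is maximized over a compact cylinder. Stopping at
    \<open>T\<close> before the final time keeps its top slice inside the open region.\<close>
  have bound: "H (x, T) \<le> B" if x: "x \<in> disc (1 / 4)" and T: "0 < T" "T < t\<^sub>0" for x T
  proof -
    let ?K = "cball (0 :: real ^ 2) (3 / 8) \<times> {0..T}"
    have KS: "?K \<subseteq> S" using T by (auto simp: S_def)
    have "compact ?K" by (intro compact_Times) auto
    moreover have "(x, T) \<in> ?K" using x T by auto
    moreover have "continuous_on ?K H" using contH KS by (rule continuous_on_subset)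
    ultimately obtain p where p: "p \<in> ?K" "\<And>q. q \<in> ?K \<Longrightarrow> H q \<le> H p"
      using continuous_attains_sup[of ?K H] by blast
    have pS: "p \<in> S" using p KS by blast
    have np: "norm (fst p) \<le> 3 / 8" "0 \<le> snd p" "snd p \<le> T" using p(1) by auto
    have "H p \<le> B"
    \<comment> \<open>On the parabolic boundary no differential inequality is needed:
      \<open>H\<close> vanishes on the lateral side, and initially \<open>F\<close> equals
      \<open>G\<close>.\<close>
    proof (cases "norm (fst p) = 3 / 8 \<or> snd p = 0")
      case True
      then show ?thesis
      proof
        assume "norm (fst p) = 3 / 8"
        then have "\<rho> p = 0" unfolding \<rho>_def by (simp only:) (simp add: power2_eq_square)
        then show ?thesis using BC by (simp add: H_def)
      next
        assume 0: "snd p = 0"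
        have "(norm (fst p))\<^sup>2 \<le> (3 / 8)\<^sup>2" using np by (intro power_mono) auto
        then have "0 \<le> \<rho> p" by (simp add: \<rho>_def power2_eq_square)
        moreover have "\<rho> p \<le> 1"
          using zero_le_power2[of "norm (fst p)"] unfolding \<rho>_def by linarith
        ultimately have "(\<rho> p)\<^sup>2 * G p \<le> 1 * C\<^sub>2"
          using G0 GC[OF pS] by (intro mult_mono power_le_one) auto
        then show ?thesis using 0 BC by (simp add: H_def F_def)
      qed
    next
      case False
      have int: "fst p \<in> ball 0 (3 / 8)" "0 < snd p" using False np by auto
      have "(norm (fst p))\<^sup>2 < (3 / 8)\<^sup>2" using int by (intro power_strict_mono) auto
      then have \<rho>: "0 < \<rho> p" by (simp add: \<rho>_def power2_eq_square)
      have ev: "\<forall>\<^sub>F s in nhds 0. H (p + s *\<^sub>R (b, 0)) \<le> H p" for b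
      proof -
        have "\<forall>\<^sub>F s in nhds (0::real). p + s *\<^sub>R (b, 0) \<in> ball 0 (3 / 8) \<times> {0..T}"
          using open_along_Times[OF open_ball[of 0 "3/8"], of b "{0..T}"] int np
          unfolding open_along_def by (auto simp: mem_Times_iff)
        then show ?thesis by eventually_elim (rule p(2), auto)
      qed
      have evt: "\<forall>\<^sub>F s in at_left 0. H (p + s *\<^sub>R (0, 1)) \<le> H p"
        unfolding eventually_at_left_field
      proof (intro exI[of _ "- snd p"] conjI allI impI)
        fix s assume "- snd p < s" "s < 0"
        then show "H (p + s *\<^sub>R (0, 1)) \<le> H p" using np by (intro p(2)) (auto simp: mem_Times_iff)
      qed (use int in auto)
      have "snd p * exp (f p) \<le> 1 / 8"
        using vt[of "fst p" "snd p"] pS vf[OF pS] by simp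
      moreover have "p \<in> ?\<Omega>" using int np T by (auto simp: mem_Times_iff)
      ultimately show ?thesis
        unfolding B_def using \<rho> np T t\<^sub>0 GC[OF pS] ev evt
        by (intro interior_max_estimate) auto
    qed
    then show ?thesis using p(2)[OF \<open>(x, T) \<in> ?K\<close>] by simp
  qed
  have R: "- s * R (x, s) \<le> B * (64 / 5)\<^sup>2" if s: "s \<in> {0<..<t\<^sub>0}" for s
  proof -
    have "(norm x)\<^sup>2 \<le> (1 / 4)\<^sup>2" using x by (intro power_mono) auto
    \<comment> \<open>This is 9/64 - 1/16.\<close>
    then have "5 / 64 \<le> \<rho> (x, s)" by (simp add: \<rho>_def power2_eq_square)
    then have \<rho>: "(5 / 64)\<^sup>2 \<le> (\<rho> (x, s))\<^sup>2" by (intro power_mono) auto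
    show ?thesis
    \<comment> \<open>Only a nonnegative \<open>F\<close> allows the cutoff to be replaced by its
      lower bound; otherwise \<open>- s * R (x, s)\<close> is negative, being at most
      \<open>F\<close>.\<close>
    proof (cases "0 \<le> F (x, s)")
      case True
      have "(5 / 64)\<^sup>2 * F (x, s) \<le> B"
        using mult_right_mono[OF \<rho> True] bound[OF x, of s] s by (simp add: H_def)
      then have "F (x, s) \<le> B * (64 / 5)\<^sup>2" by (simp add: power2_eq_square)
      then show ?thesis using G0[of "(x, s)"] by (simp add: F_def)
    next
      case False
      have "0 \<le> B * (64 / 5)\<^sup>2" using BC by simp
      then show ?thesis using False G0[of "(x, s)"] unfolding F_def snd_conv by linarith
    qed
  qed
  have xS: "(x, s) \<in> S" if "s \<in> {0..t\<^sub>0}" for s using x that by (auto simp: S_def)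
  \<comment> \<open>Continuity in time carries the bound to the final time.\<close>
  have "continuous_on {0..t\<^sub>0} (\<lambda>s. - s * R (x, s))"
    using xS by (intro continuous_intros continuous_on_compose2[OF contR]) auto
  then have "- t * R (x, t) \<le> B * (64 / 5)\<^sup>2"
    using t t\<^sub>0 R continuous_le_on_closure[of "{0<..<t\<^sub>0}" "\<lambda>s. - s * R (x, s)" t "B * (64 / 5)\<^sup>2"] by simp
  then have "- R (x, t) \<le> B * (64 / 5)\<^sup>2 / t" using t by (simp add: field_simps)
  moreover have "gauss_curvature (\<lambda>y. v (y, t)) x = v (x, t) * - R (x, t)"
    using t by (simp add: gauss_curvature_def lap[OF xS] R_def A_def P_def flip: vf[OF xS])
  ultimately show ?thesis
    using mult_left_mono[of "- R (x, t)" "B * (64 / 5)\<^sup>2 / t" "v (x, t)"] v(2)[OF xS, of t] t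
    by (simp add: B_def mult.commute)
qed

theorem theorem3p4:
  fixes C\<^sub>2 :: real
  assumes "C\<^sub>2 > 0"
  shows "\<exists>C\<^sub>3>0. \<forall>(t\<^sub>0::real) (v :: (real ^ 2) \<times> real \<Rightarrow> real).
    0 < t\<^sub>0 \<longrightarrow> t\<^sub>0 < 1 / 2 \<longrightarrow>
    smooth_on (disc (1 / 2) \<times> {0..t\<^sub>0}) v \<longrightarrow>
    conformal_ricci_flow_on (disc (1 / 2)) t\<^sub>0 v \<longrightarrow>
    (\<forall>x\<in>disc (1 / 2). \<forall>t\<in>{0..t\<^sub>0}. v (x, t) \<ge> 1) \<longrightarrow>
    (\<forall>x\<in>disc (1 / 2). \<forall>t\<in>{0..t\<^sub>0}.
      conf_grad_norm_sq (\<lambda>y. exp (2 * v (y, t))) (\<lambda>y. ln (v (y, t))) x \<le> C\<^sub>2) \<longrightarrow>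
    bdd_above (v ` (disc (1 / 2) \<times> {0..t\<^sub>0})) \<longrightarrow>
    t\<^sub>0 \<le> 1 / (8 * Sup (v ` (disc (1 / 2) \<times> {0..t\<^sub>0}))) \<longrightarrow>
    (\<forall>x\<in>disc (1 / 4). \<forall>t\<in>{0<..t\<^sub>0}.
      gauss_curvature (\<lambda>y. v (y, t)) x \<le> C\<^sub>3 * v (x, t) / t)"
proof (intro exI[of _ "(11 + 20 * C\<^sub>2 + 2 * C\<^sub>2\<^sup>2) * (64 / 5)\<^sup>2"] conjI allI impI ballI)
  show "0 < (11 + 20 * C\<^sub>2 + 2 * C\<^sub>2\<^sup>2) * (64 / 5)\<^sup>2" using assms by (simp add: add_pos_pos)
  fix t\<^sub>0 :: real and v :: "(real ^ 2) \<times> real \<Rightarrow> real" and x t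
  let ?S = "disc (1 / 2) \<times> {0..t\<^sub>0}"
  assume t\<^sub>0: "0 < t\<^sub>0" "t\<^sub>0 < 1 / 2"
    and v: "smooth_on ?S v" "conformal_ricci_flow_on (disc (1 / 2)) t\<^sub>0 v"
      "\<forall>x\<in>disc (1 / 2). \<forall>t\<in>{0..t\<^sub>0}. v (x, t) \<ge> 1"
      "\<forall>x\<in>disc (1 / 2). \<forall>t\<in>{0..t\<^sub>0}.
        conf_grad_norm_sq (\<lambda>y. exp (2 * v (y, t))) (\<lambda>y. ln (v (y, t))) x \<le> C\<^sub>2"
    and bdd: "bdd_above (v ` ?S)" and M: "t\<^sub>0 \<le> 1 / (8 * Sup (v ` ?S))"
    and xt: "x \<in> disc (1 / 4)" "t \<in> {0<..t\<^sub>0}"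
  have sup: "v p \<le> Sup (v ` ?S)" if "p \<in> ?S" for p
    using bdd that by (intro cSup_upper) auto
  \<comment> \<open>Positivity of the supremum is needed to clear the denominator.\<close>
  have "1 \<le> Sup (v ` ?S)"
    using order_trans[OF _ sup[of "(0, 0)"], of 1] v(3) t\<^sub>0 by simp
  then have t\<^sub>0M: "t\<^sub>0 * Sup (v ` ?S) \<le> 1 / 8" using M by (simp add: field_simps)
  have "s * v (y, s) \<le> 1 / 8" if "(y, s) \<in> ?S" for y s
  proof -
    have "s * v (y, s) \<le> t\<^sub>0 * Sup (v ` ?S)"
      using that sup[OF that] order_trans[OF zero_le_one, of "v (y, s)"] v(3) t\<^sub>0
      by (intro mult_mono) auto
    then show ?thesis using t\<^sub>0M by simp
  qed
  then show "gauss_curvature (\<lambda>y. v (y, t)) x \<le> (11 + 20 * C\<^sub>2 + 2 * C\<^sub>2\<^sup>2) * (64 / 5)\<^sup>2 * v (x, t) / t"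
    using t\<^sub>0 v xt by (intro curvature_bound_interior) auto
qed

end
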